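(* Let $\mu$ be a Borel probability measure on $2^\omega$ and let $A\subseteq 2^\omega\times2^\omega$. If player II has a winning strategy in the two-dimensional measure game $G_2(0,A)$, then player II has a winning strategy in the measure game $G(0,B)$, where $B=\{x\in 2^\omega: \text{II has a winning strategy in } G(0,A_x)\}$ and $A_x=\{y\in 2^\omega:(x,y)\in A\}$.
   Context: $2^\omega$ is the space of infinite binary sequences with the product topology; for $t\in2^{<\omega}$, $N_t=\{x\in2^\omega:t\subseteq x\}$, and $t^\frown i$ is $t$ extended by $i$. Measure game $G(s,A)$ for $A\subseteq2^\omega$, $s\in[0,1)$: in round $n$, after II has played $t=x_0\dots x_{n-1}$, I plays $(m_{t^\frown0},m_{t^\frown1})$, then II plays $x_n$; $m_\emptyset=m_0+m_1$. I must obey: all $m_t$ rational; $m_0+m_1>s$; $0\le m_t\le\mu(N_t)$; $\mu(N_t)>0\Rightarrow m_t<\mu(N_t)$; $m_{t^\frown0}+m_{t^\frown1}=m_t$. II must obey: $x_n\in\{0,1\}$ and $m_{x_0\dots x_n}\ne0$. First rule-violator loses; otherwise II wins iff $(x_0,x_1,\dots)\in A$. The game $G_2(s,A)$ for $A\subseteq2^\omega\times2^\omega$ is the analogous game for $\mu\times\mu$: a sequence $t=(a_0,b_0)\dots(a_{n-1},b_{n-1})\in(2\times2)^{n}$ is identified with the pair $(t_0,t_1)=(a_0\dots a_{n-1},b_0\dots b_{n-1})$. In each round, after II has played $t$, I plays four numbers $m_{t^\frown(i,j)}$, $(i,j)\in2\times2$, and II plays $x_n\in 2\times 2$. I must obey: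 all $m_t$ rational; $m_{(0,0)}+m_{(0,1)}+m_{(1,0)}+m_{(1,1)}>s$; $0\le m_t\le(\mu\times\mu)(N_{t_0}\times N_{t_1})$; if $(\mu\times\mu)(N_{t_0}\times N_{t_1})>0$ then $m_t<(\mu\times\mu)(N_{t_0}\times N_{t_1})$; $\sum_{(i,j)}m_{t^\frown(i,j)}=m_t$. II must obey $x_n\in 2\times 2$ and $m_{x_0\dots x_n}\ne0$. If both follow the rules, the play of II determines a point $(x,y)\in2^\omega\times2^\omega$ (first and second coordinates of the $x_n$), and II wins iff $(x,y)\in A$. *)

theory Defs
  imports "HOL-Probability.Probability"
begin

definition cyl :: "bool list \<Rightarrow> (nat \<Rightarrow> bool) set" where
  "cyl t = {x. \<forall>i<length t. x i = t ! i}"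

text \<open>
  The one- and two-dimensional games are instances of one game in which player II picks letters
  from a finite alphabet \<open>'b\<close> (\<open>bool\<close>, respectively \<open>bool \<times> bool\<close>; the rule that II plays a letter
  is built into the type) and \<open>w t\<close> is the measure of the basic open set determined by the finite
  word \<open>t\<close>. A run consists of a sequence \<open>p\<close> of moves of player I and a sequence \<open>x\<close> of moves of
  player II: if \<open>t\<close> is the word of the first \<open>n\<close> letters of \<open>x\<close>, then \<open>p n j\<close> is the number
  $m_{t^\frown j}$ played by I in round \<open>n\<close>.
\<close>

definition word :: "(nat \<Rightarrow> 'b) \<Rightarrow> nat \<Rightarrow> 'b list" where
  "word x n = map x [0..<n]"

text \<open>The number $m_t$ for the word \<open>t\<close> of the first \<open>n\<close> letters of \<open>x\<close>.\<close>

fun node_val :: "(nat \<Rightarrow> 'b::finite \<Rightarrow> real) \<Rightarrow> (nat \<Rightarrow> 'b) \<Rightarrow> nat \<Rightarrow> real" where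
  "node_val p x 0 = (\<Sum>j\<in>UNIV. p 0 j)"
| "node_val p x (Suc n) = p n (x n)"

definition admissible :: "real \<Rightarrow> real \<Rightarrow> bool" where
  "admissible c m \<longleftrightarrow> m \<in> \<rat> \<and> 0 \<le> m \<and> m \<le> c \<and> (c > 0 \<longrightarrow> m < c)"

text \<open>The number at the empty word is fixed by the first move of I, so it is checked in round 0.\<close>

definition I_legal ::
  "('b::finite list \<Rightarrow> real) \<Rightarrow> real \<Rightarrow> (nat \<Rightarrow> 'b \<Rightarrow> real) \<Rightarrow> (nat \<Rightarrow> 'b) \<Rightarrow> nat \<Rightarrow> bool" where
  "I_legal w s p x n \<longleftrightarrow>
     (\<forall>j. admissible (w (word x n @ [j])) (p n j)) \<and>
     (\<Sum>j\<in>UNIV. p n j) = node_val p x n \<and>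
     (n = 0 \<longrightarrow> admissible (w []) (node_val p x 0) \<and> node_val p x 0 > s)"

definition II_legal :: "(nat \<Rightarrow> 'b \<Rightarrow> real) \<Rightarrow> (nat \<Rightarrow> 'b) \<Rightarrow> nat \<Rightarrow> bool" where
  "II_legal p x n \<longleftrightarrow> p n (x n) \<noteq> 0"

text \<open>Within a round I moves before II, hence the form of the first disjunct.\<close>

definition II_wins_run ::
  "('b::finite list \<Rightarrow> real) \<Rightarrow> real \<Rightarrow> (nat \<Rightarrow> 'b) set \<Rightarrow> (nat \<Rightarrow> 'b \<Rightarrow> real) \<Rightarrow> (nat \<Rightarrow> 'b) \<Rightarrow> bool"
  where
  "II_wins_run w s C p x \<longleftrightarrow>
     (\<exists>n. \<not> I_legal w s p x n \<and> (\<forall>k<n. I_legal w s p x k \<and> II_legal p x k)) \<or>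
     (\<forall>n. I_legal w s p x n \<and> II_legal p x n) \<and> x \<in> C"

text \<open>
  A strategy for II maps the list of completed rounds and the current move of I to a letter.
\<close>

type_synonym 'b II_strategy = "(('b \<Rightarrow> real) \<times> 'b) list \<Rightarrow> ('b \<Rightarrow> real) \<Rightarrow> 'b"

definition follows :: "'b II_strategy \<Rightarrow> (nat \<Rightarrow> 'b \<Rightarrow> real) \<Rightarrow> (nat \<Rightarrow> 'b) \<Rightarrow> bool" where
  "follows \<sigma> p x \<longleftrightarrow> (\<forall>n. x n = \<sigma> (map (\<lambda>k. (p k, x k)) [0..<n]) (p n))"

definition II_has_winning_strategy ::
  "('b::finite list \<Rightarrow> real) \<Rightarrow> real \<Rightarrow> (nat \<Rightarrow> 'b) set \<Rightarrow> bool" where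
  "II_has_winning_strategy w s C \<longleftrightarrow>
     (\<exists>\<sigma> :: 'b II_strategy. \<forall>p x. follows \<sigma> p x \<longrightarrow> II_wins_run w s C p x)"

definition II_wins_G :: "(nat \<Rightarrow> bool) measure \<Rightarrow> real \<Rightarrow> (nat \<Rightarrow> bool) set \<Rightarrow> bool" where
  "II_wins_G \<mu> s A \<longleftrightarrow> II_has_winning_strategy (\<lambda>t. measure \<mu> (cyl t)) s A"

definition II_wins_G2 ::
  "(nat \<Rightarrow> bool) measure \<Rightarrow> real \<Rightarrow> ((nat \<Rightarrow> bool) \<times> (nat \<Rightarrow> bool)) set \<Rightarrow> bool" where
  "II_wins_G2 \<mu> s A \<longleftrightarrow>
     II_has_winning_strategy
       (\<lambda>t. measure (\<mu> \<Otimes>\<^sub>M \<mu>) (cyl (map fst t) \<times> cyl (map snd t))) s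
       {z. (fst \<circ> z, snd \<circ> z) \<in> A}"

end

theory Submission
  imports Defs
begin

text \<open>
  Player II wins the game with \<open>s = 0\<close> iff the payoff set is conull, so the theorem is Fubini's theorem.

  If the payoff set is conull and I declares the total mass \<open>m > 0\<close>, then II fixes an open set \<open>U\<close> of
  measure less than \<open>m\<close> covering the complement and always moves to a word \<open>t\<close> whose mass exceeds the
  measure of \<open>U\<close> inside the cylinder of \<open>t\<close>; such a run cannot end in \<open>U\<close>.

  Conversely, let \<open>\<sigma>\<close> be a winning strategy and let I start with total mass \<open>\<epsilon>\<close>. At each position
  the letters that \<open>\<sigma>\<close> can be made to play are reached by moves whose masses, together with the measures
  of the cylinders of the unreachable letters, add up to barely more than the current mass. In the
  resulting tree of positions the dead branches have total measure at most \<open>2 \<epsilon>\<close>, and every other branch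
  is a run won by II.
\<close>

section \<open>Cylinders and outer regularity\<close>

lemma length_word [simp]: "length (word x n) = n"
  by (simp add: word_def)

lemma word_Suc: "word x (Suc n) = word x n @ [x n]"
  by (simp add: word_def)

lemma word_eq_iff: "word x (length t) = t \<longleftrightarrow> (\<forall>i<length t. x i = t ! i)"
  unfolding list_eq_iff_nth_eq by (simp add: word_def)

lemma cyl_eq_word: "cyl t = {x. word x (length t) = t}"
  by (simp add: cyl_def word_eq_iff)

lemma cyl_append: "cyl (t @ [j]) = cyl t \<inter> {x. x (length t) = j}"
  by (auto simp: cyl_def nth_append less_Suc_eq)

lemma open_cyl: "open (cyl t)"
proof -
  have "open {f :: nat \<Rightarrow> bool. \<forall>i\<in>{..<length t}. f i \<in> {t ! i}}"
    by (rule product_topology_basis') (auto simp: discrete_topology_class.open_discrete)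
  then show ?thesis by (simp add: cyl_def Ball_def)
qed

lemma open_contains_cyl:
  assumes "open U" "x \<in> U"
  obtains n where "cyl (word x n) \<subseteq> U"
proof -
  have "openin (product_topology (\<lambda>i::nat. euclidean :: bool topology) UNIV) U"
    using assms(1) by (simp add: open_fun_def)
  from product_topology_open_contains_basis[OF this assms(2)]
  obtain X where X: "x \<in> (\<Pi>\<^sub>E i\<in>UNIV. X i)" "finite {i. X i \<noteq> UNIV}" "(\<Pi>\<^sub>E i\<in>UNIV. X i) \<subseteq> U"
    by auto
  obtain n where n: "\<forall>i\<in>{i. X i \<noteq> UNIV}. i < n"
    using iffD1[OF finite_nat_set_iff_bounded X(2)] ..
  have "cyl (word x n) \<subseteq> (\<Pi>\<^sub>E i\<in>UNIV. X i)"
  proof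
    fix y assume "y \<in> cyl (word x n)"
    then have eq: "y i = x i" if "i < n" for i
      using that by (simp add: cyl_def word_def)
    have "y i \<in> X i" for i
    proof (cases "i < n")
      case True
      then show ?thesis using PiE_mem[OF X(1), of i] by (simp add: eq)
    next
      case False
      then have "X i = UNIV" using n by blast
      then show ?thesis by simp
    qed
    then show "y \<in> (\<Pi>\<^sub>E i\<in>UNIV. X i)" by (simp add: PiE_iff)
  qed
  from order_trans[OF this X(3)] show thesis by (rule that)
qed

lemma open_eq_Union_cyl:
  assumes "open U"
  shows "U = (\<Union>t\<in>{t. cyl t \<subseteq> U}. cyl t)"
proof
  show "U \<subseteq> (\<Union>t\<in>{t. cyl t \<subseteq> U}. cyl t)"
  proof
    fix x assume "x \<in> U"
    then obtain n where "cyl (word x n) \<subseteq> U"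
      using assms open_contains_cyl by blast
    moreover have "x \<in> cyl (word x n)" by (simp add: cyl_eq_word)
    ultimately show "x \<in> (\<Union>t\<in>{t. cyl t \<subseteq> U}. cyl t)" by blast
  qed
qed auto

text \<open>There are only countably many words, so each open set is a countable union of cylinders,
  and a cylinder constrains finitely many coordinates.\<close>

lemma measurable_into_Cantor:
  fixes f :: "'a \<Rightarrow> nat \<Rightarrow> bool"
  assumes "\<And>n. Measurable.pred M (\<lambda>a. f a n)"
  shows "f \<in> borel_measurable M"
proof (rule borel_measurableI)
  fix U :: "(nat \<Rightarrow> bool) set"
  assume "open U"
  have "f -` U \<inter> space M = (\<Union>t\<in>{t. cyl t \<subseteq> U}. {a \<in> space M. f a \<in> cyl t})"
    by (subst open_eq_Union_cyl[OF \<open>open U\<close>]) auto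
  also have "\<dots> \<in> sets M"
  proof (rule sets.countable_UN')
    show "(\<lambda>t. {a \<in> space M. f a \<in> cyl t}) ` {t. cyl t \<subseteq> U} \<subseteq> sets M"
    proof (rule image_subsetI)
      fix t
      have "Measurable.pred M (\<lambda>a. \<forall>i<length t. f a i = t ! i)"
        using assms by measurable
      then show "{a \<in> space M. f a \<in> cyl t} \<in> sets M"
        unfolding cyl_def mem_Collect_eq pred_def .
    qed
  qed simp
  finally show "f -` U \<inter> space M \<in> sets M" .
qed

text \<open>\<open>bool\<close> is not an instance of \<open>metric_space\<close>, so regularity is transported from the Polish
  space \<open>nat \<Rightarrow> real\<close> along the embedding \<open>e\<close> with Borel left inverse \<open>r\<close>.\<close>

lemma null_set_open_cover:
  fixes \<mu> :: "(nat \<Rightarrow> bool) measure"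
  assumes "prob_space \<mu>" "sets \<mu> = sets borel" "N \<in> null_sets \<mu>" "0 < \<epsilon>"
  obtains U where "open U" "N \<subseteq> U" "measure \<mu> U < \<epsilon>"
proof -
  interpret prob_space \<mu> by fact
  define e :: "(nat \<Rightarrow> bool) \<Rightarrow> nat \<Rightarrow> real" where "e x n = of_bool (x n)" for x n
  define r :: "(nat \<Rightarrow> real) \<Rightarrow> nat \<Rightarrow> bool" where "r y n \<longleftrightarrow> y n > 0" for y n
  have re: "r (e x) = x" for x by (auto simp: e_def r_def)
  have sp: "space \<mu> = UNIV"
    using sets_eq_imp_space_eq[OF assms(2)] by simp
  have cont: "continuous_on UNIV e"
  proof (rule continuous_on_coordinatewise_then_product)
    fix i
    have "continuous_on UNIV (of_bool :: bool \<Rightarrow> real)"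
      by (simp add: continuous_on_open_vimage discrete_topology_class.open_discrete)
    then have "continuous_on UNIV (of_bool \<circ> (\<lambda>x::nat \<Rightarrow> bool. x i) :: _ \<Rightarrow> real)"
      by (intro continuous_on_compose continuous_on_product_coordinates)
        (rule continuous_on_subset, auto)
    then show "continuous_on UNIV (\<lambda>x. e x i)" by (simp add: e_def comp_def)
  qed
  then have e [measurable]: "e \<in> borel_measurable \<mu>"
    using borel_measurable_continuous_onI measurable_cong_sets[OF assms(2) refl] by blast
  have r [measurable]: "r \<in> borel_measurable borel"
  proof (rule measurable_into_Cantor)
    fix n
    have "(\<lambda>y::nat \<Rightarrow> real. y n) \<in> borel_measurable borel"
      by (intro borel_measurable_continuous_onI continuous_on_product_coordinates)
    then show "Measurable.pred borel (\<lambda>y. r y n)"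
      unfolding r_def by measurable
  qed
  define \<nu> where "\<nu> = distr \<mu> borel e"
  interpret \<nu>: prob_space \<nu>
    unfolding \<nu>_def by (rule prob_space_distr) fact
  have N: "N \<in> sets borel" "emeasure \<mu> N = 0"
    using assms(2,3) by auto
  \<comment> \<open>Preimages under the Borel map \<open>r\<close> are Borel, so outer regularity
    applies to this copy of \<open>N\<close> directly, without examining the image of
    \<open>N\<close> under \<open>e\<close>.\<close>
  have B: "r -` N \<in> sets borel"
    using measurable_sets[OF r N(1)] by simp
  have "e -` r -` N = N" by (auto simp: re)
  then have "emeasure \<nu> (r -` N) = 0"
    unfolding \<nu>_def using B N sp by (simp add: emeasure_distr)
  moreover have "emeasure \<nu> (r -` N) = (INF U\<in>{U. r -` N \<subseteq> U \<and> open U}. emeasure \<nu> U)"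
    by (rule outer_regular) (use B in \<open>auto simp: \<nu>_def emeasure_distr e \<nu>.emeasure_finite\<close>)
  ultimately have "(INF U\<in>{U. r -` N \<subseteq> U \<and> open U}. emeasure \<nu> U) < ennreal \<epsilon>"
    using assms(4) by simp
  then obtain V where V: "r -` N \<subseteq> V" "open V" "emeasure \<nu> V < ennreal \<epsilon>"
    by (auto simp: INF_less_iff)
  show thesis
  proof
    show "open (e -` V)"
      using cont V(2) by (simp add: continuous_on_open_vimage)
    show "N \<subseteq> e -` V" using V(1) re by (metis subsetI subsetD vimageI2 vimageD)
    have "emeasure \<mu> (e -` V) = emeasure \<nu> V"
      unfolding \<nu>_def using V(2) sp by (simp add: emeasure_distr)
    then show "measure \<mu> (e -` V) < \<epsilon>"
      using V(3) by (metis emeasure_eq_measure ennreal_less_iff measure_nonneg)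
  qed
qed

section \<open>Conull payoff sets are won by II\<close>

text \<open>\<open>C\<close> is an arbitrary set: what gets covered by an open set is a measurable
  null set \<open>N\<close> containing its complement.\<close>

lemma II_wins_G_if_AE:
  fixes \<mu> :: "(nat \<Rightarrow> bool) measure"
  assumes "prob_space \<mu>" "sets \<mu> = sets borel" "AE x in \<mu>. x \<in> C"
  shows "II_wins_G \<mu> 0 C"
proof -
  interpret prob_space \<mu> by fact
  have sp: "space \<mu> = UNIV"
    using sets_eq_imp_space_eq[OF assms(2)] by simp
  obtain N where N: "N \<in> null_sets \<mu>" "- C \<subseteq> N"
    using assms(3) sp by (auto simp: eventually_ae_filter Collect_neg_eq)
  \<comment> \<open>The cover is chosen for every possible total mass \<open>m\<close>, since the
    strategy is fixed before I declares one.\<close>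
  have "\<forall>m. \<exists>U. 0 < m \<longrightarrow> open U \<and> N \<subseteq> U \<and> prob U < m"
    using null_set_open_cover[OF assms(1,2) N(1)] by metis
  then obtain U where U: "\<And>m. 0 < m \<Longrightarrow> open (U m) \<and> N \<subseteq> U m \<and> prob (U m) < m"
    by metis
  \<comment> \<open>The declared total is recovered from I's first move, which is the current move
    exactly when the history is empty.\<close>
  define root :: "((bool \<Rightarrow> real) \<times> bool) list \<Rightarrow> (bool \<Rightarrow> real) \<Rightarrow> real"
    where "root h p = (\<Sum>j\<in>UNIV. (if h = [] then p else fst (hd h)) j)" for h p
  define \<sigma> :: "bool II_strategy" where
    "\<sigma> h p = (SOME j. p j > prob (cyl (map snd h @ [j]) \<inter> U (root h p)))" for h p
  have "II_wins_run (\<lambda>t. prob (cyl t)) 0 C p x" if f: "follows \<sigma> p x" for p x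
  proof -
    let ?w = "\<lambda>t. prob (cyl t)"
    define V where "V = U (\<Sum>j\<in>UNIV. p 0 j)"
    have h: "map snd (map (\<lambda>k. (p k, x k)) [0..<n]) = word x n" for n
      by (simp add: word_def comp_def)
    have root: "root (map (\<lambda>k. (p k, x k)) [0..<n]) (p n) = (\<Sum>j\<in>UNIV. p 0 j)" for n
      by (cases n) (simp_all add: root_def upt_rec)
    have step: "p n (x n) > prob (cyl (word x (Suc n)) \<inter> V)"
      if V: "open V" and gt: "node_val p x n > prob (cyl (word x n) \<inter> V)"
        and leg: "I_legal ?w 0 p x n" for n
    proof -
      have meas: "cyl t \<inter> V \<in> events" for t
        using V open_cyl assms(2) by simp
      have split: "prob (cyl t \<inter> V)
          = prob (cyl (t @ [False]) \<inter> V) + prob (cyl (t @ [True]) \<inter> V)" for t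
      proof -
        have "cyl t \<inter> V = (cyl (t @ [False]) \<inter> V) \<union> (cyl (t @ [True]) \<inter> V)"
          by (auto simp: cyl_append)
        moreover have "(cyl (t @ [False]) \<inter> V) \<inter> (cyl (t @ [True]) \<inter> V) = {}"
          by (auto simp: cyl_append)
        ultimately show ?thesis
          using finite_measure_Union[OF meas meas] by metis
      qed
      \<comment> \<open>Masses and measures both add up over the two extensions, so a strict
        inequality at the word survives at one of them.\<close>
      have "\<exists>j. p n j > prob (cyl (word x n @ [j]) \<inter> V)"
      proof (rule ccontr)
        assume "\<not> ?thesis"
        then have "p n False + p n True \<le> prob (cyl (word x n) \<inter> V)"
          unfolding split[of "word x n"] by (meson add_mono not_less)
        moreover have "node_val p x n = p n False + p n True"
          using leg by (simp add: I_legal_def UNIV_bool)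
        ultimately show False using gt by simp
      qed
      then have "p n (\<sigma> (map (\<lambda>k. (p k, x k)) [0..<n]) (p n))
          > prob (cyl (word x n @ [\<sigma> (map (\<lambda>k. (p k, x k)) [0..<n]) (p n)]) \<inter> V)"
        unfolding \<sigma>_def root h V_def by (rule someI_ex)
      moreover have "\<sigma> (map (\<lambda>k. (p k, x k)) [0..<n]) (p n) = x n"
        using spec[OF f[unfolded follows_def]] by (rule sym)
      ultimately show ?thesis by (simp only: word_Suc)
    qed
    \<comment> \<open>Legality in round 0 is a separate premise because at \<open>n = 0\<close> the
      first one is vacuous, while positivity of the total mass is already needed.\<close>
    have inv: "open V \<and> N \<subseteq> V \<and> prob (cyl (word x n) \<inter> V) < node_val p x n"
      if "\<forall>k<n. I_legal ?w 0 p x k" "I_legal ?w 0 p x 0" for n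
      using that
    proof (induction n)
      case 0
      then have "0 < (\<Sum>j\<in>UNIV. p 0 j)" by (simp add: I_legal_def)
      from U[OF this] show ?case by (simp add: V_def word_def cyl_def)
    next
      case (Suc n)
      then show ?case using step[of n] by simp
    qed
    have II: "II_legal p x n" if "\<forall>k\<le>n. I_legal ?w 0 p x k" for n
      using inv[of "Suc n"] that measure_nonneg[of \<mu> "cyl (word x (Suc n)) \<inter> V"]
      by (auto simp: II_legal_def less_Suc_eq_le)
    show ?thesis
    proof (cases "\<forall>n. I_legal ?w 0 p x n")
      case True
      have "x \<in> C"
      proof (rule ccontr)
        assume "x \<notin> C"
        then have "x \<in> V" using N inv[of 0] True by auto
        then obtain n where n: "cyl (word x n) \<subseteq> V"
          using inv[of 0] True open_contains_cyl by blast
        \<comment> \<open>Once the cylinder lies inside \<open>V\<close>, the invariant makes the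
          mass exceed the measure of the whole cylinder, against the rules for I.\<close>
        have "cyl (word x (Suc n)) \<inter> V = cyl (word x (Suc n))"
          using n by (auto simp: word_Suc cyl_append)
        then have "prob (cyl (word x (Suc n))) < p n (x n)"
          using inv[of "Suc n"] True by simp
        moreover have "p n (x n) \<le> prob (cyl (word x (Suc n)))"
          using True by (simp add: I_legal_def admissible_def word_Suc)
        ultimately show False by simp
      qed
      with True II show ?thesis by (simp add: II_wins_run_def)
    next
      case False
      then obtain n where "\<not> I_legal ?w 0 p x n" "\<forall>k<n. I_legal ?w 0 p x k"
        using exists_least_iff[of "\<lambda>n. \<not> I_legal ?w 0 p x n"] by blast
      with II show ?thesis unfolding II_wins_run_def
        by (metis le_less_trans)
    qed
  qed
  then show ?thesis
    unfolding II_wins_G_def II_has_winning_strategy_def by blast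
qed

section \<open>Payoff sets won by II are conull\<close>

text \<open>Greedy induction on \<open>S\<close>. It supplies a rational move for I that stays
  strictly below every positive bound; the case \<open>m = 0\<close> covers a remainder that is
  already used up.\<close>

lemma rational_split_below:
  fixes c :: "'b \<Rightarrow> real"
  assumes "finite S" "\<And>j. j \<in> S \<Longrightarrow> 0 \<le> c j" "m \<in> \<rat>" "0 \<le> m" "m = 0 \<or> m < sum c S"
  shows "\<exists>p. (\<forall>j\<in>S. p j \<in> \<rat> \<and> 0 \<le> p j \<and> p j \<le> c j \<and> (0 < c j \<longrightarrow> p j < c j)) \<and> sum p S = m"
  using assms
proof (induction S arbitrary: m rule: finite_induct)
  case empty
  then show ?case by simp
next
  case (insert a S)
  have "\<exists>q\<in>\<rat>. 0 \<le> q \<and> q \<le> m \<and> q \<le> c a \<and> (0 < c a \<longrightarrow> q < c a) \<and> (m - q = 0 \<or> m - q < sum c S)"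
  proof (cases "c a = 0 \<or> m < c a")
    case True
    then show ?thesis
    proof
      assume "c a = 0"
      with insert show ?thesis by (intro bexI[of _ 0]) auto
    next
      assume "m < c a"
      with insert show ?thesis by (intro bexI[of _ m]) auto
    qed
  next
    case False
    then have c: "0 < c a" "c a \<le> m" using insert.prems(1)[of a] by auto
    \<comment> \<open>This makes the interval from \<open>max 0 (m - sum c S)\<close> to
      \<open>c a\<close> nonempty; a share in it leaves a remainder strictly below
      \<open>sum c S\<close>.\<close>
    then have "m < c a + sum c S" using insert by auto
    then have "max 0 (m - sum c S) < c a" using c by auto
    then obtain q where q: "q \<in> \<rat>" "max 0 (m - sum c S) < q" "q < c a"
      using Rats_dense_in_real by blast
    with c show ?thesis by (intro bexI[of _ q]) auto
  qed
  then obtain q where q: "q \<in> \<rat>" "0 \<le> q" "q \<le> m" "q \<le> c a" "0 < c a \<longrightarrow> q < c a"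
    "m - q = 0 \<or> m - q < sum c S" by blast
  have "m - q \<in> \<rat>" "0 \<le> m - q" using q insert.prems by auto
  then obtain p where p: "\<forall>j\<in>S. p j \<in> \<rat> \<and> 0 \<le> p j \<and> p j \<le> c j \<and> (0 < c j \<longrightarrow> p j < c j)"
    "sum p S = m - q"
    using insert.IH[of "m - q"] insert.prems(1) q(6) by blast
  have "sum (p(a := q)) S = sum p S"
    using insert.hyps by (intro sum.cong) auto
  then have "sum (p(a := q)) (insert a S) = m"
    using insert.hyps p(2) by simp
  moreover have "\<forall>j\<in>insert a S. (p(a := q)) j \<in> \<rat> \<and> 0 \<le> (p(a := q)) j \<and> (p(a := q)) j \<le> c j
      \<and> (0 < c j \<longrightarrow> (p(a := q)) j < c j)"
    using p(1) q by auto
  ultimately show ?case by blast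
qed

text \<open>Points of an arbitrary probability space are read as infinite words through
  \<open>X\<close>. This lets the product space serve the game over pairs of bits without moving its
  measure to a space of words.\<close>

locale coded_prob_space = prob_space M for M :: "'a measure" +
  fixes X :: "'a \<Rightarrow> nat \<Rightarrow> 'b::finite"
  assumes letter_event: "\<And>n j. {a \<in> space M. X a n = j} \<in> events"
begin

definition cell :: "'b list \<Rightarrow> 'a set" where
  "cell t = {a \<in> space M. word (X a) (length t) = t}"

abbreviation w :: "'b list \<Rightarrow> real" where
  "w t \<equiv> prob (cell t)"

lemma cell_append: "cell (t @ [j]) = cell t \<inter> {a \<in> space M. X a (length t) = j}"
proof -
  have "word x (length (t @ [j])) = t @ [j] \<longleftrightarrow> word x (length t) = t \<and> x (length t) = j" for x
    by (simp add: word_Suc)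
  then show ?thesis unfolding cell_def by blast
qed

lemma cell_Nil: "cell [] = space M"
  by (simp add: cell_def word_def)

lemma cell_event [simp]: "cell t \<in> events"
proof (induction t rule: rev_induct)
  case Nil
  show ?case unfolding cell_Nil by (rule sets.top)
next
  case (snoc j t)
  then show ?case unfolding cell_append by (intro sets.Int letter_event)
qed

lemma sum_w_append: "(\<Sum>j\<in>UNIV. w (t @ [j])) = w t"
proof -
  have "cell t \<subseteq> space M" by (simp add: sets.sets_into_space)
  then have "cell t = (\<Union>j. cell (t @ [j]))"
    unfolding cell_append by blast
  then have "w t = prob (\<Union>j. cell (t @ [j]))" by simp
  also have "\<dots> = (\<Sum>j\<in>UNIV. w (t @ [j]))"
  proof (rule finite_measure_finite_Union)
    show "disjoint_family_on (\<lambda>j. cell (t @ [j])) UNIV"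
      unfolding disjoint_family_on_def cell_append by blast
  qed auto
  finally show ?thesis by simp
qed

end

text \<open>The bounds on \<open>\<epsilon>\<close> make it a total mass that I may declare, as the
  whole space has measure 1.\<close>

locale II_winning = coded_prob_space M X for M :: "'a measure" and X :: "'a \<Rightarrow> nat \<Rightarrow> 'b::finite" +
  fixes \<sigma> :: "'b II_strategy" and C :: "(nat \<Rightarrow> 'b) set" and \<epsilon> :: real
  assumes winning: "\<And>p x. follows \<sigma> p x \<Longrightarrow> II_wins_run w 0 C p x"
    and eps: "\<epsilon> \<in> \<rat>" "0 < \<epsilon>" "\<epsilon> < 1"
begin

text \<open>Only positions in which I declares the total mass \<open>\<epsilon>\<close> are considered.\<close>

definition val :: "(('b \<Rightarrow> real) \<times> 'b) list \<Rightarrow> real" where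
  "val h = (if h = [] then \<epsilon> else fst (last h) (snd (last h)))"

definition legal_move :: "(('b \<Rightarrow> real) \<times> 'b) list \<Rightarrow> ('b \<Rightarrow> real) \<Rightarrow> bool" where
  "legal_move h p \<longleftrightarrow> (\<forall>j. admissible (w (map snd h @ [j])) (p j)) \<and> (\<Sum>j\<in>UNIV. p j) = val h"

text \<open>Legality of II's replies is not built in; it is derived from \<open>winning\<close> in
  \<open>reply_nonzero\<close>.\<close>

inductive position :: "(('b \<Rightarrow> real) \<times> 'b) list \<Rightarrow> bool" where
  Nil: "position []"
| snoc: "position h \<Longrightarrow> legal_move h p \<Longrightarrow> \<sigma> h p = j \<Longrightarrow> position (h @ [(p, j)])"

lemma position_snoc_iff:
  "position (h @ [(p, j)]) \<longleftrightarrow> position h \<and> legal_move h p \<and> \<sigma> h p = j"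
  by (subst position.simps) auto

abbreviation hist :: "(nat \<Rightarrow> 'b \<Rightarrow> real) \<Rightarrow> (nat \<Rightarrow> 'b) \<Rightarrow> nat \<Rightarrow> (('b \<Rightarrow> real) \<times> 'b) list" where
  "hist p x n \<equiv> map (\<lambda>k. (p k, x k)) [0..<n]"

lemma position_hist_Suc:
  "position (hist p x (Suc n)) \<longleftrightarrow>
     position (hist p x n) \<and> legal_move (hist p x n) (p n) \<and> \<sigma> (hist p x n) (p n) = x n"
  by (simp add: position_snoc_iff)

lemma position_hist_mono: "position (hist p x n) \<Longrightarrow> m \<le> n \<Longrightarrow> position (hist p x m)"
proof (induction n)
  case (Suc n)
  then show ?case using position_hist_Suc le_Suc_eq by metis
qed simp

lemma I_legal_if_legal_move:
  assumes "legal_move (hist p x n) (p n)"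
  shows "I_legal w 0 p x n"
proof -
  have s: "map snd (hist p x n) = word x n"
    by (simp add: word_def comp_def)
  have "admissible (w []) \<epsilon>"
    using eps by (simp add: admissible_def cell_Nil prob_space)
  then show ?thesis
    using assms eps(2) unfolding legal_move_def I_legal_def s
    by (cases n) (auto simp: val_def)
qed

lemma ex_follows: "\<exists>x. follows \<sigma> p x"
proof -
  define H where "H = rec_nat [] (\<lambda>n h. h @ [(p n, \<sigma> h (p n))])"
  have H: "H 0 = []" "H (Suc n) = H n @ [(p n, \<sigma> (H n) (p n))]" for n
    by (simp_all add: H_def)
  have "hist p (\<lambda>n. \<sigma> (H n) (p n)) n = H n" for n
    by (induction n) (simp_all add: H)
  then show ?thesis unfolding follows_def by metis
qed

text \<open>The letters of a position are forced by \<open>\<sigma>\<close>, so every run against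
  the same moves of I passes through it.\<close>

lemma hist_eq_position:
  assumes "position h" "\<forall>k<length h. p k = fst (h ! k)" "follows \<sigma> p x"
  shows "hist p x (length h) = h"
  using assms
proof (induction rule: position.induct)
  case Nil
  then show ?case by simp
next
  case (snoc h q j)
  then have "\<forall>k<length h. p k = fst (h ! k)" "p (length h) = q"
    by (auto simp: nth_append less_Suc_eq)
  moreover from this snoc have "hist p x (length h) = h" by blast
  moreover have "x (length h) = \<sigma> (hist p x (length h)) (p (length h))"
    using snoc.prems unfolding follows_def by blast
  ultimately show ?case using snoc by simp
qed

text \<open>Otherwise II would be the first to break the rules in a run extending the position.\<close>

lemma reply_nonzero:
  assumes "position h" "legal_move h q"
  shows "q (\<sigma> h q) \<noteq> 0"
proof -
  \<comment> \<open>After the position I repeats \<open>q\<close> forever; these later moves may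
    break the rules, but only rounds up to \<open>length h\<close> matter.\<close>
  define p where "p k = (if k < length h then fst (h ! k) else q)" for k
  obtain x where f: "follows \<sigma> p x" using ex_follows by blast
  let ?n = "length h"
  have hist: "hist p x ?n = h"
    using hist_eq_position[OF assms(1) _ f] by (simp add: p_def)
  have q: "p ?n = q" by (simp add: p_def)
  have x: "x ?n = \<sigma> h q"
    using f hist q unfolding follows_def by metis
  have "position (hist p x (Suc ?n))"
    unfolding position_hist_Suc hist q using assms x by simp
  then have "I_legal w 0 p x k" if "k \<le> ?n" for k
    using position_hist_mono[of p x "Suc ?n" "Suc k"] that
    by (intro I_legal_if_legal_move) (simp add: position_hist_Suc del: upt_Suc)
  with winning[OF f] have "II_legal p x ?n"
    unfolding II_wins_run_def by (metis not_less)
  then show ?thesis by (simp add: II_legal_def q x)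
qed

lemma val_position:
  assumes "position h"
  shows "val h \<in> \<rat> \<and> 0 < val h"
  using assms
proof (cases rule: position.cases)
  case Nil
  then show ?thesis using eps by (simp add: val_def)
next
  case (snoc h' p j)
  then have "p j \<in> \<rat>" "0 \<le> p j" "p j \<noteq> 0"
    using reply_nonzero by (auto simp: legal_move_def admissible_def)
  then show ?thesis by (simp add: val_def snoc(1))
qed

text \<open>The infimum of the masses at which a letter gets chosen, and the whole cell of the letter if it
  is never chosen. If these exceeded the current mass in total, I could stay below all of them.\<close>

lemma cheap_moves:
  assumes h: "position h" and \<delta>: "0 < \<delta>"
  shows "\<exists>q. (\<Sum>j\<in>UNIV. if position (h @ [(q j, j)]) then q j j else w (map snd h @ [j])) \<le> val h + \<delta>"
proof -
  define P where "P j = {p j |p. legal_move h p \<and> \<sigma> h p = j}" for j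
  define c where "c j = (if P j = {} then w (map snd h @ [j]) else Inf (P j))" for j
  have P: "0 \<le> v \<and> v \<le> w (map snd h @ [j])" if "v \<in> P j" for v j
    using that by (auto simp: P_def legal_move_def admissible_def)
  have bdd: "bdd_below (P j)" for j using P by (meson bdd_belowI)
  have c_le: "c j \<le> v" if "v \<in> P j" for v j
    using that bdd cInf_lower by (auto simp: c_def)
  have c0: "0 \<le> c j" for j
    using P by (auto simp: c_def intro!: cInf_greatest)
  have cw: "c j \<le> w (map snd h @ [j])" for j
  proof (cases "P j = {}")
    case False
    then obtain v where "v \<in> P j" by blast
    with c_le P show ?thesis using order_trans by blast
  qed (simp add: c_def)
  have total: "sum c UNIV \<le> val h"
  proof (rule ccontr)
    assume "\<not> ?thesis"
    then obtain p where p: "\<And>j. p j \<in> \<rat> \<and> 0 \<le> p j \<and> p j \<le> c j \<and> (0 < c j \<longrightarrow> p j < c j)"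
      "sum p UNIV = val h"
      using rational_split_below[of UNIV c "val h"] val_position[OF h] c0 by force
    have "admissible (w (map snd h @ [j])) (p j)" for j
      using p(1)[of j] cw[of j] c0[of j] by (auto simp: admissible_def)
    then have leg: "legal_move h p" using p(2) by (simp add: legal_move_def)
    define j where "j = \<sigma> h p"
    \<comment> \<open>The chosen letter has \<open>c j \<le> p j\<close>, while
      \<open>p j < c j\<close> if \<open>c j\<close> is positive. Hence both are 0, which a legal
      reply excludes.\<close>
    have "c j \<le> p j" using leg by (intro c_le) (auto simp: P_def j_def)
    moreover have "p j \<noteq> 0" using reply_nonzero[OF h leg] by (simp add: j_def)
    ultimately show False using p(1)[of j] by auto
  qed
  define d where "d = \<delta> / real CARD('b)"
  have d: "0 < d" using \<delta> by (simp add: d_def)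
  have "\<exists>p. (if position (h @ [(p, j)]) then p j else w (map snd h @ [j])) \<le> c j + d" for j
  proof (cases "P j = {}")
    case True
    then have "\<not> position (h @ [(p, j)])" for p
      by (auto simp: P_def position_snoc_iff)
    then show ?thesis using True d by (simp add: c_def)
  next
    case False
    have "\<exists>v\<in>P j. v < c j + d"
      using False d cInf_lessD[OF False, of "c j + d"] by (simp add: c_def)
    then obtain p where "legal_move h p" "\<sigma> h p = j" "p j < c j + d"
      by (auto simp: P_def)
    with h show ?thesis by (intro exI[of _ p]) (simp add: position_snoc_iff)
  qed
  then obtain q where
    q: "\<And>j. (if position (h @ [(q j, j)]) then q j j else w (map snd h @ [j])) \<le> c j + d"
    by metis
  have "(\<Sum>j\<in>UNIV. if position (h @ [(q j, j)]) then q j j else w (map snd h @ [j]))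
      \<le> (\<Sum>j\<in>UNIV. c j + d)"
    by (rule sum_mono) (rule q)
  also have "\<dots> = sum c UNIV + \<delta>"
    by (simp add: sum.distrib d_def)
  finally show ?thesis using total by (intro exI[of _ q]) simp
qed

section \<open>The tree of cheap positions and its total mass\<close>

definition slack :: "nat \<Rightarrow> real" where
  "slack n = \<epsilon> / 2 ^ Suc n / real (CARD('b) ^ n)"

definition Q :: "(('b \<Rightarrow> real) \<times> 'b) list \<Rightarrow> 'b \<Rightarrow> 'b \<Rightarrow> real" where
  "Q h = (SOME q. (\<Sum>j\<in>UNIV. if position (h @ [(q j, j)]) then q j j else w (map snd h @ [j]))
            \<le> val h + slack (length h))"

text \<open>Defined for all words: beyond the last genuine position it continues with unspecified
  moves, and \<open>position (pos t)\<close> tells whether \<open>t\<close> is still alive.\<close>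

definition pos :: "'b list \<Rightarrow> (('b \<Rightarrow> real) \<times> 'b) list" where
  "pos = foldl (\<lambda>h j. h @ [(Q h j, j)]) []"

lemma pos_Nil [simp]: "pos [] = []"
  by (simp add: pos_def)

lemma pos_append [simp]: "pos (t @ [j]) = pos t @ [(Q (pos t) j, j)]"
  by (simp add: pos_def)

lemma map_snd_pos [simp]: "map snd (pos t) = t"
  by (induction t rule: rev_induct) auto

lemma length_pos [simp]: "length (pos t) = length t"
  by (metis length_map map_snd_pos)

text \<open>A dead word counts with its full measure, so the sum over a level bounds the measure of
  the dead part of that level.\<close>

definition mass :: "'b list \<Rightarrow> real" where
  "mass t = (if position (pos t) then val (pos t) else w t)"

text \<open>At a live word this is \<open>cheap_moves\<close>; at a dead word all extensions are
  dead and the measure is additive.\<close>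

lemma sum_mass_append: "(\<Sum>j\<in>UNIV. mass (t @ [j])) \<le> mass t + slack (length t)"
proof (cases "position (pos t)")
  case True
  have "0 < slack (length t)" using eps by (simp add: slack_def)
  from someI_ex[OF cheap_moves[OF True this], folded length_pos, folded Q_def]
  have "(\<Sum>j\<in>UNIV. if position (pos t @ [(Q (pos t) j, j)]) then Q (pos t) j j else w (t @ [j]))
      \<le> val (pos t) + slack (length t)"
    unfolding map_snd_pos length_pos .
  moreover have "mass (t @ [j])
      = (if position (pos t @ [(Q (pos t) j, j)]) then Q (pos t) j j else w (t @ [j]))" for j
    by (simp add: mass_def val_def)
  ultimately show ?thesis using True by (simp add: mass_def)
next
  case False
  then have "mass (t @ [j]) = w (t @ [j])" for j
    by (simp add: mass_def position_snoc_iff)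
  moreover have "0 \<le> slack (length t)" using eps by (simp add: slack_def)
  ultimately show ?thesis using False by (simp add: sum_w_append mass_def)
qed

lemma finite_words: "finite {t :: 'b list. length t = n}"
  using finite_lists_length_eq[of "UNIV :: 'b set" n] by simp

lemma card_words: "card {t :: 'b list. length t = n} = CARD('b) ^ n"
  using card_lists_length_eq[of "UNIV :: 'b set" n] by simp

text \<open>The \<open>CARD('b) ^ n\<close> words of length \<open>n\<close> have total slack
  \<open>\<epsilon> / 2 ^ Suc n\<close>, and these errors form a geometric series added to the
  initial mass \<open>\<epsilon>\<close>.\<close>

lemma sum_mass: "(\<Sum>t | length t = n. mass t) \<le> \<epsilon> * (2 - 1 / 2 ^ n)"
proof (induction n)
  case 0
  have "{t :: 'b list. length t = 0} = {[]}" by auto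
  then show ?case by (simp add: mass_def val_def position.Nil)
next
  case (Suc n)
  let ?W = "\<lambda>n. {t :: 'b list. length t = n}"
  have inj: "inj_on (\<lambda>(t, j). t @ [j]) (?W n \<times> UNIV)"
    by (auto simp: inj_on_def)
  have "?W (Suc n) = (\<lambda>(t, j). t @ [j]) ` (?W n \<times> UNIV)"
  proof
    show "?W (Suc n) \<subseteq> (\<lambda>(t, j). t @ [j]) ` (?W n \<times> UNIV)"
    proof
      fix t assume "t \<in> ?W (Suc n)"
      then show "t \<in> (\<lambda>(t, j). t @ [j]) ` (?W n \<times> UNIV)"
        by (cases t rule: rev_cases) auto
    qed
  qed auto
  then have "sum mass (?W (Suc n)) = (\<Sum>(t, j)\<in>?W n \<times> UNIV. mass (t @ [j]))"
    by (simp only: sum.reindex[OF inj]) (simp add: case_prod_unfold)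
  also have "\<dots> = (\<Sum>t\<in>?W n. \<Sum>j\<in>UNIV. mass (t @ [j]))"
    by (simp add: sum.cartesian_product)
  also have "\<dots> \<le> (\<Sum>t\<in>?W n. mass t + slack n)"
    using sum_mass_append by (intro sum_mono) auto
  also have "\<dots> = sum mass (?W n) + \<epsilon> / 2 ^ Suc n"
    by (simp add: sum.distrib card_words slack_def)
  also have "\<dots> \<le> \<epsilon> * (2 - 1 / 2 ^ n) + \<epsilon> / 2 ^ Suc n"
    using Suc by simp
  also have "\<dots> = \<epsilon> * (2 - 1 / 2 ^ Suc n)"
    by (simp add: field_simps)
  finally show ?case .
qed

section \<open>Measure of the dead branches\<close>

definition dead :: "nat \<Rightarrow> 'a set" where
  "dead n = {a \<in> space M. \<not> position (pos (word (X a) n))}"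

lemma dead_eq: "dead n = (\<Union>t\<in>{t. length t = n \<and> \<not> position (pos t)}. cell t)"
  by (auto simp: dead_def cell_def)

lemma dead_event: "dead n \<in> events"
proof -
  have "finite {t. length t = n \<and> \<not> position (pos t)}"
    by (rule finite_subset[OF _ finite_words[of n]]) blast
  then show ?thesis unfolding dead_eq by (intro sets.finite_UN cell_event)
qed

text \<open>Live words have positive mass, so discarding them from the level sum leaves an upper
  bound for the dead ones.\<close>

lemma prob_dead: "prob (dead n) \<le> 2 * \<epsilon>"
proof -
  let ?D = "{t. length t = n \<and> \<not> position (pos t)}"
  have "finite ?D" by (rule finite_subset[OF _ finite_words[of n]]) blast
  then have "prob (dead n) \<le> (\<Sum>t\<in>?D. w t)"
    unfolding dead_eq by (intro finite_measure_subadditive_finite) auto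
  also have "\<dots> = (\<Sum>t\<in>?D. mass t)"
    by (intro sum.cong) (auto simp: mass_def)
  also have "\<dots> \<le> (\<Sum>t | length t = n. mass t)"
    using val_position by (intro sum_mono2 finite_words) (auto simp: mass_def intro: less_imp_le)
  also have "\<dots> \<le> \<epsilon> * (2 - 1 / 2 ^ n)" by (rule sum_mass)
  also have "\<dots> \<le> 2 * \<epsilon>" using eps by (simp add: right_diff_distrib)
  finally show ?thesis .
qed

text \<open>Initial segments of positions are positions, so the dead sets increase and continuity
  from below preserves the bound.\<close>

lemma prob_Union_dead: "prob (\<Union>n. dead n) \<le> 2 * \<epsilon>"
proof -
  have "incseq dead"
    by (intro incseq_SucI) (auto simp: dead_def word_Suc position_snoc_iff)
  then have "(\<lambda>n. prob (dead n)) \<longlonglongrightarrow> prob (\<Union>n. dead n)"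
    using dead_event by (intro finite_Lim_measure_incseq) auto
  then show ?thesis
    by (rule LIMSEQ_le_const2) (use prob_dead in auto)
qed

text \<open>The positions along \<open>x\<close> are the histories of one run that follows
  \<open>\<sigma>\<close> and in which I never breaks a rule; II can win it only by reaching
  \<open>C\<close>.\<close>

lemma in_payoff_if_never_dead:
  assumes "\<And>n. position (pos (word x n))"
  shows "x \<in> C"
proof -
  define p where "p n = Q (pos (word x n)) (x n)" for n
  have hist: "hist p x n = pos (word x n)" for n
    by (induction n) (simp_all add: p_def word_Suc, simp add: word_def)
  have *: "legal_move (hist p x n) (p n) \<and> \<sigma> (hist p x n) (p n) = x n" for n
    using assms[of "Suc n"] unfolding hist[symmetric] position_hist_Suc by blast
  then have "follows \<sigma> p x" by (simp add: follows_def)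
  moreover have "I_legal w 0 p x n" for n
    using * I_legal_if_legal_move by blast
  ultimately show ?thesis
    using winning unfolding II_wins_run_def by blast
qed

end

lemma (in coded_prob_space) AE_if_II_has_winning_strategy:
  assumes "II_has_winning_strategy w 0 C"
  shows "AE a in M. X a \<in> C"
proof -
  obtain \<sigma> where \<sigma>: "\<And>p x. follows \<sigma> p x \<Longrightarrow> II_wins_run w 0 C p x"
    using assms unfolding II_has_winning_strategy_def by blast
  \<comment> \<open>The shift by 2 keeps the total mass below 1 even at \<open>n = 0\<close>. The
    exceptional set is only covered by events, whose intersection turns out to be null.\<close>
  have "\<exists>D\<in>events. prob D \<le> 2 * inverse (real (n + 2)) \<and> {a \<in> space M. X a \<notin> C} \<subseteq> D" for n
  proof -
    interpret W: II_winning M X \<sigma> C "inverse (real (n + 2))"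
      by unfold_locales (use \<sigma> in \<open>auto simp: inverse_less_1_iff\<close>)
    have "{a \<in> space M. X a \<notin> C} \<subseteq> (\<Union>n. W.dead n)"
      unfolding W.dead_def using W.in_payoff_if_never_dead by blast
    moreover have "(\<Union>n. W.dead n) \<in> events"
      using W.dead_event by blast
    ultimately show ?thesis using W.prob_Union_dead by blast
  qed
  then have "\<exists>D. \<forall>n. D n \<in> events \<and> prob (D n) \<le> 2 * inverse (real (n + 2)) \<and>
      {a \<in> space M. X a \<notin> C} \<subseteq> D n"
    by (intro choice) (simp add: Bex_def)
  then obtain D where D: "\<And>n. D n \<in> events" "\<And>n. prob (D n) \<le> 2 * inverse (real (n + 2))"
    "\<And>n. {a \<in> space M. X a \<notin> C} \<subseteq> D n"
    by auto
  have le: "prob (\<Inter>n. D n) \<le> 2 * inverse (real (n + 2))" for n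
    using D(1) by (intro order_trans[OF finite_measure_mono D(2)[of n]]) auto
  have "(\<lambda>n. 2 * inverse (real (n + 2))) \<longlonglongrightarrow> 2 * 0"
    by (intro tendsto_mult tendsto_const LIMSEQ_ignore_initial_segment[OF lim_inverse_n])
  then have "prob (\<Inter>n. D n) \<le> 2 * 0"
    by (rule LIMSEQ_le_const) (use le in blast)
  then have "(\<Inter>n. D n) \<in> null_sets M"
    using D(1) by (auto simp: null_sets_def emeasure_eq_measure measure_le_0_iff)
  then show ?thesis
    by (rule AE_I') (use D(3) in blast)
qed

theorem theorem4p4:
  fixes \<mu> :: "(nat \<Rightarrow> bool) measure"
    and A :: "((nat \<Rightarrow> bool) \<times> (nat \<Rightarrow> bool)) set"
  assumes "prob_space \<mu>"
    and "sets \<mu> = sets borel"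
    and "II_wins_G2 \<mu> 0 A"
  shows "II_wins_G \<mu> 0 {x. II_wins_G \<mu> 0 {y. (x, y) \<in> A}}"
proof -
  interpret prob_space \<mu> by fact
  interpret pair_prob_space \<mu> \<mu> ..
  define X :: "(nat \<Rightarrow> bool) \<times> (nat \<Rightarrow> bool) \<Rightarrow> nat \<Rightarrow> bool \<times> bool"
    where "X a n = (fst a n, snd a n)" for a n
  have sp: "space \<mu> = UNIV"
    using sets_eq_imp_space_eq[OF assms(2)] by simp
  have "{x. x n = b} \<in> sets \<mu>" for n b
  proof -
    have "open {f :: nat \<Rightarrow> bool. \<forall>i\<in>{n}. f i \<in> {b}}"
      by (rule product_topology_basis') (auto simp: discrete_topology_class.open_discrete)
    then show ?thesis by (simp add: assms(2))
  qed
  then have "{x. x n = b} \<times> {y. y n = c} \<in> sets (\<mu> \<Otimes>\<^sub>M \<mu>)" for n b c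
    by simp
  moreover have "{a \<in> space (\<mu> \<Otimes>\<^sub>M \<mu>). X a n = (b, c)} = {x. x n = b} \<times> {y. y n = c}" for n b c
    by (auto simp: X_def space_pair_measure sp)
  ultimately interpret coded_prob_space "\<mu> \<Otimes>\<^sub>M \<mu>" X
    by unfold_locales auto
  \<comment> \<open>This identifies the abstract weight \<open>w\<close> with the weight of the
    two-dimensional game.\<close>
  have "cell t = cyl (map fst t) \<times> cyl (map snd t)" for t
    by (auto simp: cell_def cyl_def word_eq_iff X_def space_pair_measure sp prod_eq_iff)
  then have "AE a in \<mu> \<Otimes>\<^sub>M \<mu>. X a \<in> {z. (fst \<circ> z, snd \<circ> z) \<in> A}"
    using assms(3) by (intro AE_if_II_has_winning_strategy) (simp add: II_wins_G2_def)
  then have "AE a in \<mu> \<Otimes>\<^sub>M \<mu>. a \<in> A"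
    by (simp add: X_def comp_def)
  \<comment> \<open>Almost every section of \<open>A\<close> is conull, hence won by II. So the set
    of such \<open>x\<close> is itself a conull payoff set, and the same criterion applies once
    more.\<close>
  from AE_pair[OF this] have "AE x in \<mu>. II_wins_G \<mu> 0 {y. (x, y) \<in> A}"
    by eventually_elim (simp add: II_wins_G_if_AE assms(1,2))
  then show ?thesis
    by (simp add: II_wins_G_if_AE assms(1,2))
qed

end
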